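(* Let $n\in\mathbb{N}$, let $S_1,\ldots,S_n$ be pairwise disjoint finite semigroups, let $S$ be their zero-union, and let $\mathit{NC}=\{i\in\{1,\ldots,n\} : S_i \text{ is not commutative}\}$. Suppose that $|\mathit{NC}|\geqslant 2$. Then $$\omega(\mathcal{G}(S))=\sum_{i\in\mathit{NC}}\omega(\mathcal{G}(S_i)).$$
   Context: Zero-union: for pairwise disjoint semigroups $S_1,\ldots,S_n$, their zero-union is the set $\{0\}\cup\bigcup_{i=1}^n S_i$, where $0$ is a new element, and where the product of $x$ and $y$ is the element $xy\in S_i$ if $x,y\in S_i$ for some $i$, and is $0$ in all remaining cases. The center of a semigroup $T$ is $Z(T)=\{x\in T: xy=yx \text{ for all } y\in T\}$. For a finite non-commutative semigroup $T$, the commuting graph $\mathcal{G}(T)$ is the simple graph with vertex set $T\setminus Z(T)$ in which two distinct vertices $x,y$ are adjacent if and only if $xy=yx$. $\omega(G)$ denotes the clique number of a simple graph $G$ (the size of a largest set of pairwise adjacent vertices). *)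

theory Defs
  imports
    "HOL-Algebra.Congruence"
    "HOL-Library.Disjoint_Sets"
    "Graph_Theory.Pair_Digraph"
begin

record 'a magma = "'a partial_object" +
  prod_of :: "'a \<Rightarrow> 'a \<Rightarrow> 'a"  (infixl \<open>\<cdot>\<index>\<close> 70)

text \<open>The empty semigroup is not excluded.\<close>

locale carrier_semigroup =
  fixes T :: "'a magma" (structure)
  assumes closed: "\<lbrakk>x \<in> carrier T; y \<in> carrier T\<rbrakk> \<Longrightarrow> x \<cdot> y \<in> carrier T"
    and assoc: "\<lbrakk>x \<in> carrier T; y \<in> carrier T; z \<in> carrier T\<rbrakk>
      \<Longrightarrow> (x \<cdot> y) \<cdot> z = x \<cdot> (y \<cdot> z)"

definition commutative :: "'a magma \<Rightarrow> bool" where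
  "commutative T \<longleftrightarrow>
     (\<forall>x \<in> carrier T. \<forall>y \<in> carrier T. x \<cdot>\<^bsub>T\<^esub> y = y \<cdot>\<^bsub>T\<^esub> x)"

definition center :: "'a magma \<Rightarrow> 'a set" where
  "center T = {x \<in> carrier T. \<forall>y \<in> carrier T. x \<cdot>\<^bsub>T\<^esub> y = y \<cdot>\<^bsub>T\<^esub> x}"

text \<open>
  Simple graphs are represented as symmetric, loop-free sets of ordered pairs
  (locale \<^locale>\<open>pair_graph\<close>).  The definition makes sense for every magma; for a commutative
  one it gives the graph without vertices.
\<close>

definition commuting_graph :: "'a magma \<Rightarrow> 'a pair_pre_digraph" where
  "commuting_graph T =
     \<lparr> pverts = carrier T - center T,
       parcs = {(x, y). x \<in> carrier T - center T \<and> y \<in> carrier T - center T \<and>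
                        x \<noteq> y \<and> x \<cdot>\<^bsub>T\<^esub> y = y \<cdot>\<^bsub>T\<^esub> x} \<rparr>"

lemma pair_graph_commuting_graph:
  assumes "finite (carrier T)"
  shows "pair_graph (commuting_graph T)"
proof
  show "finite (pverts (commuting_graph T))"
    using assms by (simp add: commuting_graph_def)
  show "finite (parcs (commuting_graph T))"
    by (rule finite_subset[of _ "carrier T \<times> carrier T"])
       (use assms in \<open>auto simp: commuting_graph_def\<close>)
  show "symmetric (with_proj (commuting_graph T))"
    by (auto simp: symmetric_def sym_def arcs_ends_conv commuting_graph_def)
qed (auto simp: commuting_graph_def)

definition is_clique :: "'a pair_pre_digraph \<Rightarrow> 'a set \<Rightarrow> bool" where
  "is_clique G K \<longleftrightarrow>
     K \<subseteq> pverts G \<and> (\<forall>x \<in> K. \<forall>y \<in> K. x \<noteq> y \<longrightarrow> (x, y) \<in> parcs G)"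

text \<open>Meaningful for finite graphs only, where the maximum is over a finite set containing 0.\<close>

definition clique_number :: "'a pair_pre_digraph \<Rightarrow> nat" where
  "clique_number G = Max {card K | K. is_clique G K}"

text \<open>
  The element \<open>z\<close> is the adjoined zero; it must lie outside all the carriers.  The index in
  the product is well defined when the carriers are pairwise disjoint.
\<close>

definition zero_union :: "'a \<Rightarrow> 'i set \<Rightarrow> ('i \<Rightarrow> 'a magma) \<Rightarrow> 'a magma" where
  "zero_union z I S =
     \<lparr> carrier = {z} \<union> (\<Union>i \<in> I. carrier (S i)),
       prod_of = (\<lambda>x y.
         if \<exists>i \<in> I. x \<in> carrier (S i) \<and> y \<in> carrier (S i)
         then x \<cdot>\<^bsub>S (THE i. i \<in> I \<and> x \<in> carrier (S i) \<and> y \<in> carrier (S i))\<^esub> y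
         else z) \<rparr>"

lemma zero_union_prod:
  assumes "disjoint_family_on (\<lambda>i. carrier (S i)) I" "i \<in> I"
    and "x \<in> carrier (S i)" "y \<in> carrier (S i)"
  shows "x \<cdot>\<^bsub>zero_union z I S\<^esub> y = x \<cdot>\<^bsub>S i\<^esub> y"
proof -
  have "(THE i. i \<in> I \<and> x \<in> carrier (S i) \<and> y \<in> carrier (S i)) = i"
    by (rule the_equality) (use assms in \<open>auto simp: disjoint_family_on_def\<close>)
  then show ?thesis using assms by (auto simp: zero_union_def)
qed

lemma zero_union_prod_zero:
  assumes "\<not> (\<exists>i \<in> I. x \<in> carrier (S i) \<and> y \<in> carrier (S i))"
  shows "x \<cdot>\<^bsub>zero_union z I S\<^esub> y = z"
  using assms by (auto simp: zero_union_def)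

end

theory Submission
  imports Defs
begin

text \<open>
  Elements of different components of a zero-union commute, because both of their products are
  the adjoined zero, and the zero itself is central.  Within one component the product is the old
  one.  So an element of \<open>S i\<close> is central in the zero-union exactly if it is central in \<open>S i\<close>
  (\<open>center_zero_union\<close>), and the commuting graph of the zero-union is the \<^emph>\<open>join\<close> of the
  commuting graphs of the components: their disjoint union together with all the edges between
  different components.

  A clique of a join is the same thing as an independent choice of one clique in each part
  (\<open>is_clique_join_iff\<close>), so clique numbers add up over a join (\<open>clique_number_join\<close>).
  A commutative component has no non-central elements and contributes 0 to the sum, which leaves
  the sum over the non-commutative ones.
\<close>

section \<open>Clique numbers of joins of graphs\<close>

lemma finite_clique_cards:
  assumes "finite (pverts G)"
  shows "finite {card K | K. is_clique G K}"
proof -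
  have "{card K | K. is_clique G K} \<subseteq> card ` Pow (pverts G)"
    by (auto simp: is_clique_def)
  then show ?thesis using assms by (meson finite_Pow_iff finite_imageI finite_subset)
qed

lemma card_le_clique_number:
  assumes "finite (pverts G)" "is_clique G K"
  shows "card K \<le> clique_number G"
  unfolding clique_number_def
  by (rule Max_ge[OF finite_clique_cards]) (use assms in auto)

lemma obtain_maximum_clique:
  assumes "finite (pverts G)"
  obtains K where "is_clique G K" "card K = clique_number G"
proof -
  have "is_clique G {}" by (simp add: is_clique_def)
  then have "{card K | K. is_clique G K} \<noteq> {}" by blast
  then have "clique_number G \<in> {card K | K. is_clique G K}"
    unfolding clique_number_def by (rule Max_in[OF finite_clique_cards[OF assms]])
  then show ?thesis using that by auto
qed

lemma clique_number_no_vertices: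
  assumes "pverts G = {}"
  shows "clique_number G = 0"
proof -
  obtain K where "is_clique G K" "card K = clique_number G"
    using obtain_maximum_clique[of G] assms by auto
  then show ?thesis using assms by (auto simp: is_clique_def)
qed

definition is_join :: "'a pair_pre_digraph \<Rightarrow> 'i set \<Rightarrow> ('i \<Rightarrow> 'a pair_pre_digraph) \<Rightarrow> bool" where
  "is_join H I G \<longleftrightarrow>
     pverts H = (\<Union>i \<in> I. pverts (G i)) \<and>
     (\<forall>i \<in> I. \<forall>j \<in> I. \<forall>x \<in> pverts (G i). \<forall>y \<in> pverts (G j). x \<noteq> y \<longrightarrow>
        ((x, y) \<in> parcs H \<longleftrightarrow> i \<noteq> j \<or> (x, y) \<in> parcs (G i)))"

text \<open>
  Edges between different parts are always present, so pairwise adjacency is a condition on each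
  part separately.
\<close>

lemma is_clique_join_iff:
  assumes "is_join H I G"
  shows "is_clique H K \<longleftrightarrow>
    K \<subseteq> (\<Union>i \<in> I. pverts (G i)) \<and> (\<forall>i \<in> I. is_clique (G i) (K \<inter> pverts (G i)))"
    (is "_ \<longleftrightarrow> ?sub \<and> ?parts")
proof
  assume K: "is_clique H K"
  have "(x, y) \<in> parcs (G i)"
    if "i \<in> I" "x \<in> K \<inter> pverts (G i)" "y \<in> K \<inter> pverts (G i)" "x \<noteq> y" for i x y
  proof -
    have "(x, y) \<in> parcs H" using K that by (simp add: is_clique_def)
    then show ?thesis using assms that by (simp add: is_join_def)
  qed
  moreover have ?sub using K assms by (simp add: is_clique_def is_join_def)
  ultimately show "?sub \<and> ?parts" by (simp add: is_clique_def)
next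
  assume R: "?sub \<and> ?parts"
  have "(x, y) \<in> parcs H" if xy: "x \<in> K" "y \<in> K" "x \<noteq> y" for x y
  proof -
    obtain i j where ij: "i \<in> I" "j \<in> I" "x \<in> pverts (G i)" "y \<in> pverts (G j)"
      using R xy by blast
    have "i \<noteq> j \<or> (x, y) \<in> parcs (G i)"
      using R ij xy by (auto simp: is_clique_def)
    then show ?thesis using assms ij xy by (auto simp: is_join_def)
  qed
  then show "is_clique H K" using R assms by (auto simp: is_clique_def is_join_def)
qed

text \<open>
  Cutting a clique of the join into its parts bounds its size by the sum; the union of maximum
  cliques of the parts attains this bound.
\<close>

lemma clique_number_join:
  assumes join: "is_join H I G"
    and I: "finite I"
    and fin: "\<And>i. i \<in> I \<Longrightarrow> finite (pverts (G i))"
    and disj: "disjoint_family_on (\<lambda>i. pverts (G i)) I"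
  shows "clique_number H = (\<Sum>i \<in> I. clique_number (G i))"
proof (rule antisym)
  have finH: "finite (pverts H)" using join I fin by (simp add: is_join_def)
  obtain K where K: "is_clique H K" "card K = clique_number H"
    using obtain_maximum_clique[OF finH] .
  have parts: "is_clique (G i) (K \<inter> pverts (G i))" if "i \<in> I" for i
    using K that is_clique_join_iff[OF join] by blast
  have "K = (\<Union>i \<in> I. K \<inter> pverts (G i))"
    using K is_clique_join_iff[OF join] by blast
  then have "card K \<le> (\<Sum>i \<in> I. card (K \<inter> pverts (G i)))"
    using card_UN_le[OF I, of "\<lambda>i. K \<inter> pverts (G i)"] by simp
  also have "\<dots> \<le> (\<Sum>i \<in> I. clique_number (G i))"
    by (intro sum_mono card_le_clique_number fin parts)
  finally show "clique_number H \<le> (\<Sum>i \<in> I. clique_number (G i))" using K by simp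

  have "\<exists>M. is_clique (G i) M \<and> card M = clique_number (G i)" if "i \<in> I" for i
    using obtain_maximum_clique[OF fin[OF that]] by blast
  then obtain M where M: "\<And>i. i \<in> I \<Longrightarrow> is_clique (G i) (M i)"
    "\<And>i. i \<in> I \<Longrightarrow> card (M i) = clique_number (G i)" by metis
  have sub: "M i \<subseteq> pverts (G i)" if "i \<in> I" for i
    using M that by (auto simp: is_clique_def)
  have cut: "(\<Union>j \<in> I. M j) \<inter> pverts (G i) = M i" if "i \<in> I" for i
    using sub disj that by (fastforce simp: disjoint_family_on_def)
  have "is_clique H (\<Union>i \<in> I. M i)"
    unfolding is_clique_join_iff[OF join] using cut M sub by auto
  moreover have "card (\<Union>i \<in> I. M i) = (\<Sum>i \<in> I. card (M i))"
  proof (rule card_UN_disjoint[OF I])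
    show "\<forall>i \<in> I. finite (M i)" using sub fin finite_subset by metis
    show "\<forall>i \<in> I. \<forall>j \<in> I. i \<noteq> j \<longrightarrow> M i \<inter> M j = {}"
      using sub disj by (fastforce simp: disjoint_family_on_def)
  qed
  ultimately show "(\<Sum>i \<in> I. clique_number (G i)) \<le> clique_number H"
    using card_le_clique_number[OF finH] M by fastforce
qed

section \<open>The commuting graph of a zero-union\<close>

lemma zero_union_commute_iff:
  assumes disj: "disjoint_family_on (\<lambda>i. carrier (S i)) I"
    and ij: "i \<in> I" "j \<in> I" "x \<in> carrier (S i)" "y \<in> carrier (S j)"
  shows "x \<cdot>\<^bsub>zero_union z I S\<^esub> y = y \<cdot>\<^bsub>zero_union z I S\<^esub> x \<longleftrightarrow>
    i \<noteq> j \<or> x \<cdot>\<^bsub>S i\<^esub> y = y \<cdot>\<^bsub>S i\<^esub> x"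
proof (cases "i = j")
  case True
  then show ?thesis using ij by (simp add: zero_union_prod[OF disj])
next
  case False
  have "k = i \<and> k = j" if "k \<in> I" "x \<in> carrier (S k)" "y \<in> carrier (S k)" for k
    using disjoint_family_onD[OF disj \<open>k \<in> I\<close>] ij that by blast
  with False have "\<not> (\<exists>k \<in> I. x \<in> carrier (S k) \<and> y \<in> carrier (S k))"
    by blast
  then have "x \<cdot>\<^bsub>zero_union z I S\<^esub> y = z" "y \<cdot>\<^bsub>zero_union z I S\<^esub> x = z"
    by (auto intro!: zero_union_prod_zero)
  with False show ?thesis by simp
qed

lemma zero_union_zero_prod:
  assumes "z \<notin> (\<Union>i \<in> I. carrier (S i))"
  shows "z \<cdot>\<^bsub>zero_union z I S\<^esub> x = z" "x \<cdot>\<^bsub>zero_union z I S\<^esub> z = z"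
  using assms by (auto intro!: zero_union_prod_zero)

lemma carrier_zero_union: "carrier (zero_union z I S) = insert z (\<Union>i \<in> I. carrier (S i))"
  by (simp add: zero_union_def)

lemma centerD: "x \<in> center T \<Longrightarrow> x \<in> carrier T"
  by (simp add: center_def)

text \<open>
  Commuting with the zero and with the other components is automatic, so only the component of
  the element matters.
\<close>

lemma center_zero_union:
  assumes disj: "disjoint_family_on (\<lambda>i. carrier (S i)) I"
    and zero: "z \<notin> (\<Union>i \<in> I. carrier (S i))"
  shows "center (zero_union z I S) = insert z (\<Union>i \<in> I. center (S i))"
proof -
  have parts: "x \<in> center (zero_union z I S) \<longleftrightarrow> x \<in> center (S i)"
    if i: "i \<in> I" "x \<in> carrier (S i)" for i x
  proof -
    have "x \<in> center (zero_union z I S) \<longleftrightarrow>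
        (\<forall>j \<in> I. \<forall>y \<in> carrier (S j).
          x \<cdot>\<^bsub>zero_union z I S\<^esub> y = y \<cdot>\<^bsub>zero_union z I S\<^esub> x)"
      using i by (auto simp: center_def carrier_zero_union zero_union_zero_prod[OF zero])
    also have "\<dots> \<longleftrightarrow> x \<in> center (S i)"
      using i by (auto simp: center_def zero_union_commute_iff[OF disj i(1) _ i(2)])
    finally show ?thesis .
  qed
  have z: "z \<in> center (zero_union z I S)"
    by (simp add: center_def carrier_zero_union zero_union_zero_prod[OF zero])
  show ?thesis
  proof
    show "center (zero_union z I S) \<subseteq> insert z (\<Union>i \<in> I. center (S i))"
    proof
      fix x assume x: "x \<in> center (zero_union z I S)"
      then have "x = z \<or> (\<exists>i \<in> I. x \<in> carrier (S i))"
        using centerD[OF x] by (simp add: carrier_zero_union)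
      then show "x \<in> insert z (\<Union>i \<in> I. center (S i))" using parts x by auto
    qed
    show "insert z (\<Union>i \<in> I. center (S i)) \<subseteq> center (zero_union z I S)"
    proof
      fix x assume "x \<in> insert z (\<Union>i \<in> I. center (S i))"
      then consider "x = z" | i where "i \<in> I" "x \<in> center (S i)" by auto
      then show "x \<in> center (zero_union z I S)"
        by cases (simp add: z, metis parts centerD)
    qed
  qed
qed

lemma is_join_commuting_graph_zero_union:
  assumes disj: "disjoint_family_on (\<lambda>i. carrier (S i)) I"
    and zero: "z \<notin> (\<Union>i \<in> I. carrier (S i))"
  shows "is_join (commuting_graph (zero_union z I S)) I (\<lambda>i. commuting_graph (S i))"
proof -
  have "x \<notin> center (S j)" if "i \<in> I" "j \<in> I" "x \<in> carrier (S i)" "x \<notin> center (S i)" for i j x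
    using disj that by (cases "i = j") (auto simp: disjoint_family_on_def center_def)
  then have verts: "pverts (commuting_graph (zero_union z I S)) =
      (\<Union>i \<in> I. pverts (commuting_graph (S i)))"
    using zero by (auto simp: commuting_graph_def center_zero_union[OF assms] carrier_zero_union)
  have "(x, y) \<in> parcs (commuting_graph (zero_union z I S)) \<longleftrightarrow>
      i \<noteq> j \<or> (x, y) \<in> parcs (commuting_graph (S i))"
    if "i \<in> I" "j \<in> I" "x \<in> pverts (commuting_graph (S i))"
      "y \<in> pverts (commuting_graph (S j))" "x \<noteq> y" for i j x y
  proof -
    have "x \<in> pverts (commuting_graph (zero_union z I S))"
      "y \<in> pverts (commuting_graph (zero_union z I S))"
      using verts that by auto
    moreover have "x \<in> carrier (S i)" "y \<in> carrier (S j)"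
      using that by (auto simp: commuting_graph_def)
    ultimately show ?thesis
      using that zero_union_commute_iff[OF disj that(1,2), of x y z]
      by (auto simp: commuting_graph_def)
  qed
  with verts show ?thesis by (auto simp: is_join_def)
qed

theorem corollary3p4:
  fixes n :: nat and S :: "nat \<Rightarrow> 'a magma" and z :: 'a and NC :: "nat set"
  assumes semigroups: "\<And>i. i \<in> {1..n} \<Longrightarrow> carrier_semigroup (S i)"
    and finite: "\<And>i. i \<in> {1..n} \<Longrightarrow> finite (carrier (S i))"
    and disjoint: "disjoint_family_on (\<lambda>i. carrier (S i)) {1..n}"
    and zero_new: "z \<notin> (\<Union>i \<in> {1..n}. carrier (S i))"
    and NC: "NC = {i \<in> {1..n}. \<not> commutative (S i)}"
    and two: "card NC \<ge> 2"
  shows "clique_number (commuting_graph (zero_union z {1..n} S)) =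
         (\<Sum>i \<in> NC. clique_number (commuting_graph (S i)))"
proof -
  have "clique_number (commuting_graph (zero_union z {1..n} S)) =
      (\<Sum>i \<in> {1..n}. clique_number (commuting_graph (S i)))"
  proof (rule clique_number_join)
    show "is_join (commuting_graph (zero_union z {1..n} S)) {1..n} (\<lambda>i. commuting_graph (S i))"
      by (rule is_join_commuting_graph_zero_union[OF disjoint zero_new])
    show "disjoint_family_on (\<lambda>i. pverts (commuting_graph (S i))) {1..n}"
      using disjoint by (fastforce simp: disjoint_family_on_def commuting_graph_def)
  qed (use finite in \<open>auto simp: commuting_graph_def\<close>)
  also have "\<dots> = (\<Sum>i \<in> NC. clique_number (commuting_graph (S i)))"
  proof (rule sum.mono_neutral_right)
    show "\<forall>i \<in> {1..n} - NC. clique_number (commuting_graph (S i)) = 0"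
    proof
      fix i assume "i \<in> {1..n} - NC"
      then have "commutative (S i)" by (simp add: NC)
      then have "pverts (commuting_graph (S i)) = {}"
        by (auto simp: commutative_def commuting_graph_def center_def)
      then show "clique_number (commuting_graph (S i)) = 0"
        by (rule clique_number_no_vertices)
    qed
  qed (auto simp: NC)
  finally show ?thesis .
qed

end
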